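(* Let $n\ge 2$ and let $\Pi'_n$ be the output of the greedy algorithm described in the context. Then $\Pi'_n$ is a universal word (u-word) for $n$-permutations: every permutation of $\{1,\dots,n\}$ is the reduced form of exactly one factor of length $n$ of $\Pi'_n$.
   Context: For a word $w$ of distinct integers, $\mathrm{red}(w)$ denotes the word obtained by replacing the $i$-th smallest entry of $w$ by $i$. A factor of a word is a block of consecutive letters (factors at different positions are counted separately). Extensions: for a word $\pi=\pi_1\cdots\pi_m$ of distinct integers and $1\le i\le m$, the $i$-th extension of $\pi$ is $c_b(\pi_1)\cdots c_b(\pi_m)\,b$, where $b$ is the $i$-th smallest element of $\{\pi_1,\dots,\pi_m\}$ and $c_b(x)=x$ if $x<b$, $c_b(x)=x+1$ if $x\ge b$. The $(m+1)$-st extension of $\pi$ is $\pi b$ with $b=\max_j\pi_j+1$. Greedy algorithm: start with $\Pi'_{n,0}=12\cdots(n-1)$. Given $\Pi'_{n,k}=a_1a_2\cdots a_{k+n-1}$ (a permutation of $\{1,\dots,k+n-1\}$ in which no two factors of length $n$ have the same reduced form), let $i\in\{1,\dots,n\}$ be minimal such that the $i$-th extension of $a_{k+1}\cdots a_{k+n-1}$ has reduced form different from the reduced form of every length-$n$ factor of $\Pi'_{n,k}$, let $b$ be the last element of this extension, and set $\Pi'_{n,k+1}=c_b(a_1)\cdots c_b(a_{k+n-1})\,b$. If no such $i$ exists, the algorithm terminates and outputs $\Pi'_n:=\Pi'_{n,k}$. *)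

theory Defs
  imports "HOL-Combinatorics.Multiset_Permutations"
begin

text \<open>Words are lists of natural numbers; list positions start at 0, while letters and the index of
  an extension start at 1.\<close>

definition red :: "nat list \<Rightarrow> nat list" where
  "red w = map (\<lambda>x. card {y \<in> set w. y \<le> x}) w"

text \<open>A factor occurrence of length \<open>n\<close> is identified with its starting position.\<close>

definition factor_positions :: "nat \<Rightarrow> nat list \<Rightarrow> nat set" where
  "factor_positions n w = {j. j + n \<le> length w}"

definition factor_at :: "nat \<Rightarrow> nat list \<Rightarrow> nat \<Rightarrow> nat list" where
  "factor_at n w j = take n (drop j w)"

definition bump :: "nat \<Rightarrow> nat \<Rightarrow> nat" where
  "bump b x = (if x < b then x else x + 1)"

definition extension :: "nat \<Rightarrow> nat list \<Rightarrow> nat list" where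
  "extension i p =
     (if i \<le> length p
      then let b = sorted_list_of_set (set p) ! (i - 1) in map (bump b) p @ [b]
      else p @ [Max (set p) + 1])"

definition last_letters :: "nat \<Rightarrow> nat list \<Rightarrow> nat list" where
  "last_letters m w = drop (length w - m) w"

definition admissible :: "nat \<Rightarrow> nat list \<Rightarrow> nat \<Rightarrow> bool" where
  "admissible n w i \<longleftrightarrow>
     i \<in> {1..n} \<and>
     (\<forall>j \<in> factor_positions n w.
        red (extension i (last_letters (n - 1) w)) \<noteq> red (factor_at n w j))"

definition greedy_step :: "nat \<Rightarrow> nat list \<Rightarrow> nat list option" where
  "greedy_step n w =
     (if \<exists>i. admissible n w i
      then let b = last (extension (LEAST i. admissible n w i) (last_letters (n - 1) w))
           in Some (map (bump b) w @ [b])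
      else None)"

text \<open>\<open>greedy n k\<close> is the word after \<open>k\<close> steps, and \<open>None\<close> if the algorithm has terminated
  earlier.\<close>

primrec greedy :: "nat \<Rightarrow> nat \<Rightarrow> nat list option" where
  "greedy n 0 = Some [1..<n]"
| "greedy n (Suc k) = Option.bind (greedy n k) (greedy_step n)"

definition greedy_output :: "nat \<Rightarrow> nat list \<Rightarrow> bool" where
  "greedy_output n w \<longleftrightarrow> (\<exists>k. greedy n k = Some w \<and> greedy_step n w = None)"

definition u_word :: "nat \<Rightarrow> nat list \<Rightarrow> bool" where
  "u_word n w \<longleftrightarrow>
     (\<forall>p \<in> permutations_of_set {1..n}. \<exists>!j. j \<in> factor_positions n w \<and> red (factor_at n w j) = p)"

end

theory Submission
  imports Defs
begin

text \<open>The algorithm walks in the graph of overlapping permutations, whose vertices are the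
  \<open>(n - 1)\<close>-permutations and whose edges are the \<open>n\<close>-permutations, an edge \<open>p\<close> leading from
  \<open>red (butlast p)\<close> to \<open>red (tl p)\<close>. All in- and outdegrees are \<open>n\<close>, so a walk can only get stuck at
  its start \<open>12\<dots>(n - 1)\<close>, and at that moment it is balanced at every vertex. Edges leaving a
  vertex are used in increasing order of their last letter; thus a vertex with an unused outgoing edge
  has its edge ending in \<open>n\<close> unused, and by balance the target of that edge has an unused outgoing
  edge, too. Appending a new maximum \<open>n - 1\<close> times leads from any vertex to \<open>12\<dots>(n - 1)\<close>, where all
  edges are used. Hence no edge is unused.\<close>

section \<open>Reduced forms\<close>

text \<open>A rank depends only on comparisons between letters, and \<open>f\<close> preserves
  these. The invariances under ranking, bumping and shifting all come from here.\<close>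

lemma red_map_strict_mono:
  assumes "strict_mono_on (set w) f"
  shows "red (map f w) = red w"
proof -
  have "card {y \<in> f ` set w. y \<le> f x} = card {y \<in> set w. y \<le> x}" if "x \<in> set w" for x
  proof -
    have "{y \<in> f ` set w. y \<le> f x} = f ` {y \<in> set w. y \<le> x}"
      using that strict_mono_on_less_eq[OF assms] by auto
    moreover have "inj_on f {y \<in> set w. y \<le> x}"
      using strict_mono_on_imp_inj_on[OF assms] by (rule inj_on_subset) auto
    ultimately show ?thesis by (simp add: card_image)
  qed
  then show ?thesis by (simp add: red_def)
qed

lemma rank_strict_mono_on:
  fixes S :: "nat set"
  assumes "finite S"
  shows "strict_mono_on S (\<lambda>x. card {y \<in> S. y \<le> x})"
proof (rule strict_mono_onI)
  fix r s assume "r \<in> S" "s \<in> S" "r < s"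
  then have "{y \<in> S. y \<le> r} \<subseteq> {y \<in> S. y \<le> s}" "s \<in> {y \<in> S. y \<le> s}" "s \<notin> {y \<in> S. y \<le> r}"
    by auto
  then have "{y \<in> S. y \<le> r} \<subset> {y \<in> S. y \<le> s}" by blast
  then show "card {y \<in> S. y \<le> r} < card {y \<in> S. y \<le> s}"
    using assms by (intro psubset_card_mono) auto
qed

text \<open>Ranking in \<open>w\<close> is itself a strictly increasing relabelling. Hence the end
  vertices of an edge may be computed before or after reducing the word.\<close>

lemma red_map_rank:
  assumes "set u \<subseteq> set w"
  shows "red (map (\<lambda>x. card {y \<in> set w. y \<le> x}) u) = red u"
  using rank_strict_mono_on[of "set w"] assms
  by (intro red_map_strict_mono) (auto simp: monotone_on_def)

lemma length_red [simp]: "length (red w) = length w"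
  by (simp add: red_def)

lemma red_butlast_red: "red (butlast (red w)) = red (butlast w)"
  unfolding red_def[of w] map_butlast[symmetric] by (rule red_map_rank) (auto dest: in_set_butlastD)

lemma red_tl_red: "red (tl (red w)) = red (tl w)"
  unfolding red_def[of w] map_tl[symmetric] by (rule red_map_rank) (cases w; auto)

lemma red_rev: "red (rev w) = rev (red w)"
  by (simp add: red_def rev_map)

lemma red_in_perms:
  assumes "distinct w"
  shows "red w \<in> permutations_of_set {1..length w}"
proof -
  have d: "distinct (red w)"
    using assms strict_mono_on_imp_inj_on[OF rank_strict_mono_on[of "set w"]]
    by (simp add: red_def distinct_map)
  have "set (red w) \<subseteq> {1..length w}"
  proof
    fix z assume "z \<in> set (red w)"
    then obtain x where x: "x \<in> set w" "z = card {y \<in> set w. y \<le> x}" by (auto simp: red_def)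
    have "card {y \<in> set w. y \<le> x} \<le> card (set w)" by (intro card_mono) auto
    moreover have "card {y \<in> set w. y \<le> x} > 0" using x by (auto simp: card_gt_0_iff)
    ultimately show "z \<in> {1..length w}" using x assms by (simp add: distinct_card)
  qed
  moreover have "card (set (red w)) = length w" using d by (simp add: distinct_card)
  ultimately have "set (red w) = {1..length w}"
    by (intro card_subset_eq) auto
  with d show ?thesis by (simp add: permutations_of_set_def)
qed

lemma red_perm:
  assumes "p \<in> permutations_of_set {1..n}"
  shows "red p = p"
proof -
  have s: "set p = {1..n}" using assms by (simp add: permutations_of_set_def)
  have "card {y \<in> set p. y \<le> x} = x" if "x \<in> set p" for x
  proof -
    have "{y \<in> set p. y \<le> x} = {1..x}" using s that by auto
    then show ?thesis by simp
  qed
  then show ?thesis by (simp add: red_def map_idI)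
qed

lemma length_perm: "p \<in> permutations_of_set {1..n} \<Longrightarrow> length p = n"
  using distinct_card[of p] by (simp add: permutations_of_set_def)

lemma red_factor_at_in_perms:
  assumes "distinct w" "j \<in> factor_positions n w"
  shows "red (factor_at n w j) \<in> permutations_of_set {1..n}"
proof -
  have "length (factor_at n w j) = n" "distinct (factor_at n w j)"
    using assms by (auto simp: factor_at_def factor_positions_def)
  then show ?thesis using red_in_perms[of "factor_at n w j"] by simp
qed

section \<open>The graph of overlapping permutations\<close>

text \<open>For a nonempty permutation \<open>v\<close> of length \<open>m\<close> and
  \<open>i\<close> between 1 and \<open>m + 1\<close> this is the \<open>i\<close>-th extension of
  \<open>v\<close>. Giving the last letter by its value avoids the lookup among the sorted letters
  and the separate case of a new maximum.\<close>

definition edge :: "nat list \<Rightarrow> nat \<Rightarrow> nat list" where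
  "edge v i = map (bump i) v @ [i]"

lemma last_edge [simp]: "last (edge v i) = i"
  by (simp add: edge_def)

lemma bump_strict_mono: "strict_mono (bump b)"
  by (auto simp: strict_mono_def bump_def)

lemma red_map_bump: "red (map (bump b) w) = red w"
  using bump_strict_mono by (intro red_map_strict_mono) (auto simp: monotone_on_def)

lemma distinct_bump_snoc: "distinct w \<Longrightarrow> distinct (map (bump b) w @ [b])"
  by (auto simp: distinct_map bump_def inj_on_def split: if_splits)

lemma edge_in_perms:
  assumes "v \<in> permutations_of_set {1..n - 1}" "i \<in> {1..n}"
  shows "edge v i \<in> permutations_of_set {1..n}"
proof -
  have v: "distinct v" "set v = {1..n - 1}" using assms by (auto simp: permutations_of_set_def)
  have d: "distinct (edge v i)" unfolding edge_def using v(1) by (rule distinct_bump_snoc)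
  have "set (edge v i) \<subseteq> {1..n}" using v assms(2) by (auto simp: edge_def bump_def)
  moreover have "card (set (edge v i)) = n"
    using distinct_card[OF d] length_perm[OF assms(1)] assms(2) by (simp add: edge_def)
  ultimately have "set (edge v i) = {1..n}" by (intro card_subset_eq) auto
  with d show ?thesis by (simp add: permutations_of_set_def)
qed

lemma red_butlast_edge:
  assumes "v \<in> permutations_of_set {1..m}"
  shows "red (butlast (edge v i)) = v"
  using assms by (simp add: edge_def red_map_bump red_perm)

text \<open>Deleting the letter \<open>l\<close> lowers the ranks of exactly the letters above
  \<open>l\<close> by one, and \<open>bump l\<close> undoes this. So an edge is determined by its
  source and its last letter.\<close>

lemma edge_red_butlast_last:
  assumes "p \<in> permutations_of_set {1..n}" "n \<ge> 1"
  shows "edge (red (butlast p)) (last p) = p"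
proof -
  have p: "distinct p" "set p = {1..n}" using assms by (auto simp: permutations_of_set_def)
  have ne: "p \<noteq> []" using p assms(2) by auto
  define q l where "q = butlast p" and "l = last p"
  have pq: "p = q @ [l]" using ne by (simp add: q_def l_def)
  have "insert l (set q) = {1..n}" "l \<notin> set q" using p by (simp_all add: pq)
  then have sq: "set q = {1..n} - {l}" and l: "l \<in> {1..n}" by blast+
  have "bump l (card {y \<in> set q. y \<le> x}) = x" if "x \<in> set q" for x
  proof (cases "x < l")
    case True
    have "x \<le> n" using that by (simp add: sq)
    have "{y \<in> set q. y \<le> x} = {1..x}"
      unfolding sq using True \<open>x \<le> n\<close> by auto
    with True show ?thesis by (simp add: bump_def)
  next
    case False
    then have "l < x" "x \<le> n" using that by (auto simp: sq)
    have "{y \<in> set q. y \<le> x} = {1..x} - {l}"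
      unfolding sq using \<open>x \<le> n\<close> by auto
    then have "card {y \<in> set q. y \<le> x} = x - 1" using \<open>l < x\<close> l by simp
    with \<open>l < x\<close> show ?thesis by (simp add: bump_def)
  qed
  then have "map (bump l) (red q) = q" by (simp add: red_def map_idI)
  then show ?thesis by (simp add: edge_def q_def[symmetric] l_def[symmetric] pq[symmetric])
qed

lemma red_butlast_in_perms:
  assumes "p \<in> permutations_of_set {1..n}"
  shows "red (butlast p) \<in> permutations_of_set {1..n - 1}"
  using red_in_perms[of "butlast p"] assms length_perm[OF assms]
  by (simp add: permutations_of_set_def distinct_butlast)

lemma last_perm:
  fixes n :: nat
  assumes "p \<in> permutations_of_set {1..n}" "n \<ge> 1"
  shows "last p \<in> {1..n}"
proof -
  have "p \<noteq> []" using length_perm[OF assms(1)] assms(2) by auto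
  then show ?thesis using assms(1) last_in_set[of p] by (simp add: permutations_of_set_def)
qed

section \<open>Degrees of the vertices\<close>

lemma out_edges_eq:
  assumes "v \<in> permutations_of_set {1..n - 1}" "n \<ge> 1"
  shows "{p \<in> permutations_of_set {1..n}. red (butlast p) = v} = edge v ` {1..n}"
proof (intro equalityI subsetI)
  fix p assume "p \<in> {p \<in> permutations_of_set {1..n}. red (butlast p) = v}"
  then have p: "p \<in> permutations_of_set {1..n}" "red (butlast p) = v" by auto
  then show "p \<in> edge v ` {1..n}"
    using edge_red_butlast_last[OF p(1) assms(2)] last_perm[OF p(1) assms(2)] by force
next
  fix p assume "p \<in> edge v ` {1..n}"
  then show "p \<in> {p \<in> permutations_of_set {1..n}. red (butlast p) = v}"
    using edge_in_perms[OF assms(1)] red_butlast_edge[OF assms(1)] by auto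
qed

lemma card_out_edges:
  assumes "v \<in> permutations_of_set {1..n - 1}" "n \<ge> 1"
  shows "card {p \<in> permutations_of_set {1..n}. red (butlast p) = v} = n"
proof -
  have "inj_on (edge v) {1..n}" by (rule inj_onI) (metis last_edge)
  then show ?thesis by (simp add: out_edges_eq[OF assms] card_image del: One_nat_def)
qed

text \<open>Reversing words exchanges the edges entering \<open>v\<close> with those leaving
  \<open>rev v\<close>, so indegrees reduce to outdegrees.\<close>

lemma card_in_edges:
  assumes "v \<in> permutations_of_set {1..n - 1}" "n \<ge> 1"
  shows "card {p \<in> permutations_of_set {1..n}. red (tl p) = v} = n"
proof -
  let ?E = "permutations_of_set {1..n}"
  have rev_E: "rev p \<in> ?E \<longleftrightarrow> p \<in> ?E" for p by (simp add: permutations_of_set_def)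
  have but: "red (butlast (rev p)) = rev (red (tl p))" for p :: "nat list"
    by (cases p) (simp_all add: red_rev red_def[of "[]"])
  have "rev ` {p \<in> ?E. red (tl p) = v} = {p \<in> ?E. red (butlast p) = rev v}"
  proof (intro equalityI subsetI)
    fix p assume p: "p \<in> {p \<in> ?E. red (butlast p) = rev v}"
    have "rev p \<in> {p \<in> ?E. red (tl p) = v}" using p but[of "rev p"] rev_E[of p] by simp
    then show "p \<in> rev ` {p \<in> ?E. red (tl p) = v}" by (metis image_eqI rev_rev_ident)
  qed (auto simp: red_rev butlast_rev rev_E[simplified])
  moreover have "card (rev ` {p \<in> ?E. red (tl p) = v}) = card {p \<in> ?E. red (tl p) = v}"
    by (rule card_image) (simp add: inj_on_def)
  moreover have "rev v \<in> permutations_of_set {1..n - 1}"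
    using assms(1) by (simp add: permutations_of_set_def)
  ultimately show ?thesis using card_out_edges[of "rev v" n] assms(2) by simp
qed

section \<open>Appending a letter, and the path of new maxima\<close>

lemma edge_max:
  assumes "v \<in> permutations_of_set {1..n - 1}" "n \<ge> 1"
  shows "edge v n = v @ [n]"
proof -
  have "set v = {1..n - 1}" using assms by (simp add: permutations_of_set_def)
  then show ?thesis using assms(2) by (auto simp: edge_def bump_def intro!: map_idI)
qed

text \<open>The reduced form is a permutation, hence the edge given by its source and its last
  letter. Bumping keeps the source \<open>red u\<close>, and the last letter is the rank of
  \<open>b\<close>.\<close>

lemma red_map_bump_snoc:
  assumes "distinct u"
  shows "red (map (bump b) u @ [b]) = edge (red u) (Suc (card {y \<in> set u. y < b}))"
proof -
  let ?w = "map (bump b) u @ [b]"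
  have "red ?w \<in> permutations_of_set {1..Suc (length u)}"
    using red_in_perms[OF distinct_bump_snoc[OF assms, of b]] by simp
  then have "edge (red (butlast (red ?w))) (last (red ?w)) = red ?w"
    by (rule edge_red_butlast_last) simp
  moreover have "red (butlast (red ?w)) = red u"
    by (simp add: red_butlast_red red_map_bump)
  moreover have "last (red ?w) = Suc (card {y \<in> set u. y < b})"
  proof -
    \<comment> \<open>Letters that were at least \<open>b\<close> have been bumped above
      \<open>b\<close>; the smaller ones are unchanged.\<close>
    have "{y \<in> set ?w. y \<le> b} = insert b {y \<in> set u. y < b}"
      by (auto simp: bump_def image_iff split: if_splits)
    moreover have "last (red ?w) = card {y \<in> set ?w. y \<le> b}"
      by (simp add: red_def)
    ultimately show ?thesis by simp
  qed
  ultimately show ?thesis by simp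
qed

lemma red_snoc_max:
  assumes "distinct u" "\<And>x. x \<in> set u \<Longrightarrow> x < b"
  shows "red (u @ [b]) = red u @ [Suc (length u)]"
proof -
  have "map (bump b) u = u" using assms(2) by (intro map_idI) (simp add: bump_def)
  moreover have "{y \<in> set u. y < b} = set u" using assms(2) by auto
  moreover have "edge (red u) (Suc (length u)) = red u @ [Suc (length u)]"
    using edge_max[of "red u" "Suc (length u)"] red_in_perms[OF assms(1)] by simp
  ultimately show ?thesis using red_map_bump_snoc[OF assms(1), of b] assms(1)
    by (simp add: distinct_card)
qed

text \<open>Each maximal edge drops a letter of \<open>v\<close> and appends a new maximum, so after
  \<open>n - 1\<close> of them only an increasing word remains. The path is expressed through a
  property \<open>P\<close> that is inherited along such edges, so no notion of path has to be
  introduced.\<close>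

lemma max_edges_reach_start:
  assumes v: "v \<in> permutations_of_set {1..n - 1}" and "n \<ge> 2"
    and P: "P v"
    and step: "\<And>u. u \<in> permutations_of_set {1..n - 1} \<Longrightarrow> P u \<Longrightarrow> P (red (tl (edge u n)))"
  shows "P [1..<n]"
proof -
  have dv: "distinct v" "set v = {1..n - 1}" using v by (auto simp: permutations_of_set_def)
  note lv = length_perm[OF v]
  \<comment> \<open>The window after \<open>k\<close> appended letters, left unreduced so that
    consecutive windows literally overlap.\<close>
  let ?x = "\<lambda>k. drop k v @ [n..<n + k]"
  have x: "distinct (?x k)" "\<And>z. z \<in> set (?x k) \<Longrightarrow> z < n + k" "k \<le> n - 1 \<Longrightarrow> length (?x k) = n - 1" for k
    using dv lv \<open>n \<ge> 2\<close> by (auto dest!: in_set_dropD)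
  have "k \<le> n - 1 \<Longrightarrow> P (red (?x k))" for k
  proof (induction k)
    case 0
    then show ?case using P red_perm[OF v] by simp
  next
    case (Suc k)
    have k: "k < n - 1" using Suc.prems by simp
    have u: "red (?x k) \<in> permutations_of_set {1..n - 1}"
      using red_in_perms[OF x(1)[of k]] x(3)[of k] k by simp
    have "edge (red (?x k)) n = red (?x k) @ [n]" using edge_max[OF u] \<open>n \<ge> 2\<close> by simp
    also have "\<dots> = red (?x k @ [n + k])"
      using red_snoc_max[OF x(1) x(2)] x(3)[of k] k by simp
    finally have "red (tl (edge (red (?x k)) n)) = red (tl (?x k @ [n + k]))"
      by (simp add: red_tl_red del: append_assoc)
    also have "tl (?x k @ [n + k]) = ?x (Suc k)"
    proof -
      have "drop k v \<noteq> []" using k lv by simp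
      then show ?thesis by (simp add: tl_append2 drop_Suc tl_drop)
    qed
    finally show ?case using step[OF u] Suc.IH k by simp
  qed
  \<comment> \<open>No letter of \<open>v\<close> is left now, and the window is a translate of
    \<open>[1..<n]\<close>.\<close>
  from this[of "n - 1"] have "P (red [n..<n + (n - 1)])" using lv by simp
  moreover have "[n..<n + (n - 1)] = map (\<lambda>i. i + (n - 1)) [1..<n]"
    using \<open>n \<ge> 2\<close> by (intro nth_equalityI) (auto simp: nth_upt)
  moreover have "red (map (\<lambda>i. i + (n - 1)) [1..<n]) = red [1..<n]"
    by (rule red_map_strict_mono) (auto simp: monotone_on_def)
  moreover have "red [1..<n] = [1..<n]"
    using \<open>n \<ge> 2\<close> by (intro red_perm[of _ "n - 1"]) (auto simp: permutations_of_set_def)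
  ultimately show ?thesis by simp
qed

section \<open>The greedy walk\<close>

definition used :: "nat \<Rightarrow> nat list \<Rightarrow> nat list set" where
  "used n w = (\<lambda>j. red (factor_at n w j)) ` factor_positions n w"

definition vertex :: "nat \<Rightarrow> nat list \<Rightarrow> nat list" where
  "vertex n w = red (last_letters (n - 1) w)"

section \<open>Extensions as edges\<close>

lemma extension_eq_bump_snoc:
  assumes "u \<noteq> []"
  shows "extension i u = map (bump (last (extension i u))) u @ [last (extension i u)]"
proof (cases "i \<le> length u")
  case False
  \<comment> \<open>The last case of \<open>extension\<close> does not bump, but its new letter
    exceeds all letters of \<open>u\<close>, on which bumping is then the identity.\<close>
  have "map (bump (Max (set u) + 1)) u = u"
    by (intro map_idI) (simp add: bump_def less_Suc_eq_le)
  with False show ?thesis by (simp add: extension_def)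
qed (simp add: extension_def Let_def)

text \<open>Converts the index of an extension, a position among the sorted letters, into the rank
  of the new letter, by which \<open>edge\<close> is indexed.\<close>

lemma card_less_last_extension:
  assumes "distinct u" "u \<noteq> []" "i \<in> {1..Suc (length u)}"
  shows "Suc (card {y \<in> set u. y < last (extension i u)}) = i"
proof (cases "i \<le> length u")
  case True
  let ?s = "sorted_list_of_set (set u)"
  have l: "length ?s = length u" using assms(1) by (simp add: distinct_card)
  have s: "sorted_wrt (<) ?s" by (rule strict_sorted_list_of_set)
  have less: "?s ! a < ?s ! b \<longleftrightarrow> a < b" if "a < length u" "b < length u" for a b
    using s that l by (metis linorder_neqE_nat order_less_asym sorted_wrt_nth_less less_irrefl)
  \<comment> \<open>List positions start at 0, so exactly \<open>i - 1\<close> sorted letters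
    precede the one at position \<open>i - 1\<close>.\<close>
  have "{y \<in> set u. y < ?s ! (i - 1)} = (!) ?s ` {..<i - 1}"
  proof (intro equalityI subsetI)
    fix y assume "y \<in> {y \<in> set u. y < ?s ! (i - 1)}"
    then have "y \<in> set ?s" "y < ?s ! (i - 1)" by auto
    then obtain a where "a < length u" "y = ?s ! a" "?s ! a < ?s ! (i - 1)"
      using l by (metis in_set_conv_nth)
    then show "y \<in> (!) ?s ` {..<i - 1}" using less[of a "i - 1"] True assms(3) by auto
  next
    fix y assume "y \<in> (!) ?s ` {..<i - 1}"
    then obtain a where a: "a < i - 1" "y = ?s ! a" by auto
    then have "?s ! a \<in> set ?s" using l True by (intro nth_mem) simp
    then show "y \<in> {y \<in> set u. y < ?s ! (i - 1)}" using a less[of a "i - 1"] True by auto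
  qed
  moreover have "inj_on ((!) ?s) {..<i - 1}"
    using l True by (intro inj_on_nth) auto
  ultimately show ?thesis using True assms(3) by (simp add: extension_def Let_def card_image)
next
  case False
  then have "{y \<in> set u. y < last (extension i u)} = set u"
    by (auto simp: extension_def less_Suc_eq_le)
  then show ?thesis using False assms by (simp add: distinct_card)
qed

lemma red_extension:
  assumes "distinct u" "u \<noteq> []" "i \<in> {1..Suc (length u)}"
  shows "red (extension i u) = edge (red u) i"
  using red_map_bump_snoc[OF assms(1)] card_less_last_extension[OF assms]
    extension_eq_bump_snoc[OF assms(2)] by metis

text \<open>Rewrites a greedy step as a move in the graph. Bumping keeps the reduced forms of all
  old factors, and the only new factor is the chosen extension.\<close>

lemma greedy_step_props:
  assumes w: "distinct w" "n - 1 \<le> length w" and "n \<ge> 2"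
  shows "vertex n w \<in> permutations_of_set {1..n - 1}"
    and "admissible n w i \<longleftrightarrow> i \<in> {1..n} \<and> edge (vertex n w) i \<notin> used n w"
    and "admissible n w i \<Longrightarrow> b = last (extension i (last_letters (n - 1) w)) \<Longrightarrow>
      w' = map (bump b) w @ [b] \<Longrightarrow>
      used n w' = insert (edge (vertex n w) i) (used n w) \<and>
      vertex n w' = red (tl (edge (vertex n w) i))"
proof -
  define u where "u = last_letters (n - 1) w"
  have u: "length u = n - 1" "distinct u" "u \<noteq> []"
    using assms by (simp_all add: u_def last_letters_def)
  have ext: "red (extension i u) = edge (vertex n w) i" if "i \<in> {1..n}" for i
    using red_extension[OF u(2,3), of i] u(1) that \<open>n \<ge> 2\<close> by (simp add: vertex_def u_def)
  show "vertex n w \<in> permutations_of_set {1..n - 1}"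
    using red_in_perms[OF u(2)] u(1) by (simp add: vertex_def u_def)
  show adm: "admissible n w i \<longleftrightarrow> i \<in> {1..n} \<and> edge (vertex n w) i \<notin> used n w"
    using ext[of i] unfolding admissible_def used_def u_def[symmetric] image_iff by metis
  assume "admissible n w i" and b: "b = last (extension i (last_letters (n - 1) w))"
    and w': "w' = map (bump b) w @ [b]"
  have i: "i \<in> {1..n}" using \<open>admissible n w i\<close> adm by simp
  have e: "extension i u = map (bump b) u @ [b]"
    using extension_eq_bump_snoc[OF u(3), of i] by (simp add: b u_def)
  \<comment> \<open>The start of the only new factor; it is 0 when \<open>w\<close> still has length
    \<open>n - 1\<close>.\<close>
  let ?j = "length w + 1 - n"
  have pos: "factor_positions n w' = insert ?j (factor_positions n w)"
    using assms by (auto simp: factor_positions_def w')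
  have old: "red (factor_at n w' j) = red (factor_at n w j)" if "j \<in> factor_positions n w" for j
  proof -
    have "factor_at n w' j = map (bump b) (factor_at n w j)"
      using that by (simp add: factor_at_def w' factor_positions_def take_map drop_map)
    then show ?thesis by (simp add: red_map_bump)
  qed
  have drop: "drop ?j w' = map (bump b) u @ [b]"
    using assms by (simp add: w' u_def last_letters_def drop_map)
  have new: "factor_at n w' ?j = extension i u"
    using u(1) \<open>n \<ge> 2\<close> by (simp only: factor_at_def drop e) simp
  have "used n w' = insert (red (factor_at n w' ?j)) ((\<lambda>j. red (factor_at n w' j)) ` factor_positions n w)"
    by (simp add: used_def pos)
  also have "\<dots> = insert (edge (vertex n w) i) (used n w)"
    using old ext[OF i] new by (simp add: used_def)
  finally have 1: "used n w' = insert (edge (vertex n w) i) (used n w)" .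
  \<comment> \<open>The new window is the new factor without its first letter, so the walk moves to
    the target of the edge.\<close>
  have "last_letters (n - 1) w' = drop (Suc ?j) w'"
    using assms by (simp add: last_letters_def w' Suc_diff_le)
  also have "\<dots> = tl (extension i u)"
    by (simp only: e drop[symmetric] drop_Suc tl_drop)
  finally have "vertex n w' = red (tl (red (extension i u)))"
    by (simp add: vertex_def red_tl_red)
  with 1 show "used n w' = insert (edge (vertex n w) i) (used n w) \<and>
      vertex n w' = red (tl (edge (vertex n w) i))" using ext[OF i] by simp
qed

text \<open>A word of this length has \<open>k\<close> factors of length \<open>n\<close>, so
  \<open>card (used n w) = k\<close> says that no edge is repeated. The equation is the balance of a
  walk from \<open>[1..<n]\<close> to the current vertex, in additive form because subtraction is
  truncated. The last clause records that the edges at each vertex are used in increasing order of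
  their last letter.\<close>

definition greedy_inv :: "nat \<Rightarrow> nat \<Rightarrow> nat list \<Rightarrow> bool" where
  "greedy_inv n k w \<longleftrightarrow> distinct w \<and> length w = k + n - 1 \<and> card (used n w) = k \<and>
     (\<forall>v. card {p \<in> used n w. red (butlast p) = v} + of_bool (v = vertex n w) =
          card {p \<in> used n w. red (tl p) = v} + of_bool (v = [1..<n])) \<and>
     (\<forall>v \<in> permutations_of_set {1..n - 1}. \<forall>i \<in> {1..n}. \<forall>i' \<in> {1..i}.
        edge v i \<in> used n w \<longrightarrow> edge v i' \<in> used n w)"

lemma used_subset_perms: "distinct w \<Longrightarrow> used n w \<subseteq> permutations_of_set {1..n}"
  using red_factor_at_in_perms by (auto simp: used_def)

lemma finite_used: "distinct w \<Longrightarrow> finite (used n w)"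
  by (rule finite_subset[OF used_subset_perms]) simp_all

lemma greedy_inv_step:
  assumes inv: "greedy_inv n k w" and "n \<ge> 2" and "greedy_step n w = Some w'"
  shows "greedy_inv n (Suc k) w'"
proof -
  have w: "distinct w" "n - 1 \<le> length w" using inv by (auto simp: greedy_inv_def)
  note props = greedy_step_props[OF w \<open>n \<ge> 2\<close>]
  define i where "i = (LEAST i. admissible n w i)"
  define b where "b = last (extension i (last_letters (n - 1) w))"
  have ex: "\<exists>i. admissible n w i" and w': "w' = map (bump b) w @ [b]"
    using assms(3) by (auto simp: greedy_step_def i_def b_def Let_def split: if_splits)
  have i: "admissible n w i" unfolding i_def using ex by (rule LeastI_ex)
  have least: "\<not> admissible n w i'" if "i' < i" for i'
    using not_less_Least that unfolding i_def by blast
  define x where "x = vertex n w"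
  define e where "e = edge x i"
  have in_: "i \<in> {1..n}" and e: "e \<notin> used n w"
    using props(2)[of i] i by (auto simp: e_def x_def)
  have U: "used n w' = insert e (used n w)" and V: "vertex n w' = red (tl e)"
    using props(3)[OF i b_def w'] by (auto simp: e_def x_def)
  have bl: "red (butlast e) = x" unfolding e_def x_def by (rule red_butlast_edge[OF props(1)])
  have fin: "finite (used n w)" using w(1) by (rule finite_used)
  have ins: "card {p \<in> insert e (used n w). f p = v} = card {p \<in> used n w. f p = v} + of_bool (f e = v)"
    for f and v :: "nat list"
  proof -
    have "{p \<in> insert e (used n w). f p = v} =
        (if f e = v then insert e {p \<in> used n w. f p = v} else {p \<in> used n w. f p = v})" by auto
    then show ?thesis using e fin by simp
  qed
  have "card {p \<in> used n w'. red (butlast p) = v} + of_bool (v = vertex n w') =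
      card {p \<in> used n w'. red (tl p) = v} + of_bool (v = [1..<n])" for v
  proof -
    have "card {p \<in> used n w. red (butlast p) = v} + of_bool (v = x) =
        card {p \<in> used n w. red (tl p) = v} + of_bool (v = [1..<n])"
      using inv by (simp add: greedy_inv_def x_def)
    \<comment> \<open>At its source the new edge replaces the indicator of the old vertex; at its
      target it is offset by the indicator of the new one.\<close>
    then show ?thesis
      unfolding U V ins[of "\<lambda>p. red (butlast p)"] ins[of "\<lambda>p. red (tl p)"] bl
      by (simp add: eq_commute[of v])
  qed
  moreover have "edge v a' \<in> used n w'"
    if v: "v \<in> permutations_of_set {1..n - 1}" and a: "a \<in> {1..n}" "a' \<in> {1..a}"
      and "edge v a \<in> used n w'" for v a a'
  proof (cases "edge v a = e")
    case False
    then have "edge v a \<in> used n w" using that U by auto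
    then have "edge v a' \<in> used n w" using inv v a unfolding greedy_inv_def by blast
    then show ?thesis using U by simp
  next
    case True
    then have "a = i" by (metis e_def last_edge)
    moreover have "v = x" using True bl red_butlast_edge[OF v] by metis
    \<comment> \<open>By minimality of \<open>i\<close>, the edges leaving \<open>x\<close> with a
      smaller last letter were not admissible, that is, already used.\<close>
    ultimately show ?thesis
      using props(2)[of a'] least[of a'] a U True by (cases "a' = i") (auto simp: x_def)
  qed
  moreover have "distinct w'" unfolding w' using w(1) by (rule distinct_bump_snoc)
  moreover have "length w' = Suc k + n - 1" using inv \<open>n \<ge> 2\<close> by (simp add: w' greedy_inv_def)
  moreover have "card (used n w') = Suc k" using inv U e fin by (simp add: greedy_inv_def)
  ultimately show ?thesis unfolding greedy_inv_def by blast
qed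

lemma greedy_inv_greedy:
  assumes "n \<ge> 2"
  shows "greedy n k = Some w \<Longrightarrow> greedy_inv n k w"
proof (induction k arbitrary: w)
  case 0
  then have w: "w = [1..<n]" by simp
  have "factor_positions n w = {}" using \<open>n \<ge> 2\<close> by (auto simp: factor_positions_def w)
  then have "used n w = {}" by (simp add: used_def)
  moreover have "red w = w"
    unfolding w using \<open>n \<ge> 2\<close> by (intro red_perm[of _ "n - 1"]) (auto simp: permutations_of_set_def)
  then have "vertex n w = [1..<n]" by (simp add: vertex_def last_letters_def w)
  ultimately show ?case by (simp add: greedy_inv_def w)
next
  case (Suc k)
  then show ?case using greedy_inv_step[OF _ assms] by (auto simp: bind_eq_Some_conv)
qed

section \<open>A stuck walk has used every edge\<close>

lemma used_eq_perms:
  assumes inv: "greedy_inv n k w" and "n \<ge> 2" and stuck: "greedy_step n w = None"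
  shows "used n w = permutations_of_set {1..n}"
proof -
  have w: "distinct w" "n - 1 \<le> length w" using inv by (auto simp: greedy_inv_def)
  note props = greedy_step_props[OF w \<open>n \<ge> 2\<close>]
  have n1: "n \<ge> 1" using \<open>n \<ge> 2\<close> by simp
  let ?E = "permutations_of_set {1..n}" and ?V = "permutations_of_set {1..n - 1}"
  let ?out = "\<lambda>v. {p \<in> used n w. red (butlast p) = v}" and ?in = "\<lambda>v. {p \<in> used n w. red (tl p) = v}"
  have sub: "used n w \<subseteq> ?E" using w(1) by (rule used_subset_perms)
  have bal: "card (?out v) + of_bool (v = vertex n w) = card (?in v) + of_bool (v = [1..<n])" for v
    using inv by (simp add: greedy_inv_def)
  have full: "card (?out v) = n \<longleftrightarrow> edge v ` {1..n} \<subseteq> used n w" if "v \<in> ?V" for v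
  proof -
    have "?out v \<subseteq> edge v ` {1..n}" using sub out_edges_eq[OF that n1] by auto
    moreover have "card (edge v ` {1..n}) = n"
      using card_out_edges[OF that n1] out_edges_eq[OF that n1] by simp
    moreover have "edge v ` {1..n} \<inter> used n w \<subseteq> ?out v" using red_butlast_edge[OF that] by auto
    ultimately show ?thesis
      by (metis (no_types, lifting) card_subset_eq finite_atLeastAtMost finite_imageI inf.absorb_iff1
          subset_antisym subset_iff mem_Collect_eq)
  qed
  have "edge (vertex n w) ` {1..n} \<subseteq> used n w"
    using stuck props(2) by (auto simp: greedy_step_def Let_def split: if_splits)
  then have outv: "card (?out (vertex n w)) = n" using full[OF props(1)] by simp
  have "card (?in (vertex n w)) \<le> n"
  proof -
    have "card (?in (vertex n w)) \<le> card {p \<in> ?E. red (tl p) = vertex n w}"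
      using sub by (intro card_mono) auto
    then show ?thesis using card_in_edges[OF props(1) n1] by simp
  qed
  \<comment> \<open>At any other vertex, balance would require \<open>n + 1\<close> used incoming
    edges.\<close>
  then have v0: "vertex n w = [1..<n]"
    using bal[of "vertex n w"] outv by (auto simp: of_bool_def split: if_splits)
  then have bal': "card (?out v) = card (?in v)" for v using bal[of v] by simp
  have all_full: "card (?out v) = n" if v: "v \<in> ?V" for v
  proof (rule ccontr)
    assume "card (?out v) \<noteq> n"
    then have "card (?out [1..<n]) \<noteq> n"
    proof (rule max_edges_reach_start[OF v \<open>n \<ge> 2\<close>, where P = "\<lambda>v. card (?out v) \<noteq> n"])
      fix u assume u: "u \<in> ?V" and "card (?out u) \<noteq> n"
      then have "\<not> edge u ` {1..n} \<subseteq> used n w" using full[OF u] by blast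
      then obtain i where "i \<in> {1..n}" "edge u i \<notin> used n w" by blast
      \<comment> \<open>If the edge ending in \<open>n\<close> were used, the order of use at
        \<open>u\<close> would make all edges leaving \<open>u\<close> used.\<close>
      then have un: "edge u n \<notin> used n w"
        using inv u n1 unfolding greedy_inv_def by (metis atLeastAtMost_iff order_refl)
      let ?t = "red (tl (edge u n))"
      have en: "edge u n \<in> ?E" using edge_in_perms[OF u] n1 by simp
      then have t: "?t \<in> ?V"
        using red_in_perms[of "tl (edge u n)"] length_perm[OF en]
        by (simp add: permutations_of_set_def distinct_tl)
      have "?in ?t \<subset> {p \<in> ?E. red (tl p) = ?t}" using sub en un by blast
      then have "card (?in ?t) < n"
        using card_in_edges[OF t n1] psubset_card_mono[of "{p \<in> ?E. red (tl p) = ?t}" "?in ?t"] by simp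
      then show "card (?out ?t) \<noteq> n" using bal' by simp
    qed
    then show False using outv v0 by simp
  qed
  have "?E \<subseteq> used n w"
  proof
    fix p assume p: "p \<in> ?E"
    note v = red_butlast_in_perms[OF p]
    have "edge (red (butlast p)) (last p) \<in> used n w"
      using full[OF v] all_full[OF v] last_perm[OF p n1] by blast
    then show "p \<in> used n w" using edge_red_butlast_last[OF p n1] by simp
  qed
  with sub show ?thesis by blast
qed

text \<open>Existence of a factor is the assumption on \<open>used n w\<close>. For uniqueness,
  \<open>k\<close> positions produce \<open>k\<close> different reduced forms, so the map from
  positions to reduced forms is injective.\<close>

lemma u_word_if_used_eq_perms:
  assumes inv: "greedy_inv n k w" and "n \<ge> 2" and "used n w = permutations_of_set {1..n}"
  shows "u_word n w"
proof -
  have "factor_positions n w = {..<k}"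
    using inv \<open>n \<ge> 2\<close> by (auto simp: greedy_inv_def factor_positions_def)
  then have "inj_on (\<lambda>j. red (factor_at n w j)) (factor_positions n w)"
    using inv by (intro eq_card_imp_inj_on) (auto simp: greedy_inv_def used_def)
  then show ?thesis
    unfolding u_word_def assms(3)[symmetric] used_def by (auto dest: inj_onD)
qed

section \<open>Termination and uniqueness of the output\<close>

lemma greedy_None_mono: "greedy n k = None \<Longrightarrow> k \<le> l \<Longrightarrow> greedy n l = None"
  by (rotate_tac, induction rule: dec_induct) auto

text \<open>After the terminating step \<open>greedy\<close> stays \<open>None\<close>, so two
  terminating runs must stop at the same time.\<close>

lemma greedy_output_unique:
  assumes "greedy_output n w" "greedy_output n w'"
  shows "w = w'"
proof -
  obtain k l where k: "greedy n k = Some w" "greedy_step n w = None"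
    and l: "greedy n l = Some w'" "greedy_step n w' = None"
    using assms by (auto simp: greedy_output_def)
  have "greedy n (Suc k) = None" "greedy n (Suc l) = None" using k l by auto
  then have "\<not> Suc k \<le> l" "\<not> Suc l \<le> k"
    using greedy_None_mono[of n "Suc k" l] greedy_None_mono[of n "Suc l" k] k(1) l(1) by auto
  then have "k = l" by simp
  then show ?thesis using k l by simp
qed

text \<open>Every step uses a new edge, so there cannot be more steps than
  \<open>n\<close>-permutations.\<close>

lemma greedy_output_exists:
  assumes "n \<ge> 2"
  shows "\<exists>w. greedy_output n w"
proof (rule ccontr)
  assume no: "\<nexists>w. greedy_output n w"
  have some: "\<exists>w. greedy n k = Some w" for k
  proof (induction k)
    case (Suc k)
    then obtain w where w: "greedy n k = Some w" by blast
    then have "greedy_step n w \<noteq> None" using no by (auto simp: greedy_output_def)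
    then show ?case using w by auto
  qed simp
  let ?E = "permutations_of_set {1..n}"
  obtain w where "greedy n (Suc (card ?E)) = Some w" using some by blast
  then have "greedy_inv n (Suc (card ?E)) w" by (rule greedy_inv_greedy[OF assms])
  then have "card (used n w) = Suc (card ?E)" "used n w \<subseteq> ?E"
    using used_subset_perms by (auto simp: greedy_inv_def)
  moreover have "card (used n w) \<le> card ?E" using \<open>used n w \<subseteq> ?E\<close> by (intro card_mono) auto
  ultimately show False by simp
qed

theorem theorem2p3:
  fixes n :: nat
  assumes "n \<ge> 2"
  shows "(\<exists>!w. greedy_output n w) \<and> (\<forall>w. greedy_output n w \<longrightarrow> u_word n w)"
proof (intro conjI allI impI)
  show "\<exists>!w. greedy_output n w"
    using greedy_output_exists[OF assms] greedy_output_unique by blast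
next
  fix w assume "greedy_output n w"
  then obtain k where k: "greedy n k = Some w" "greedy_step n w = None"
    by (auto simp: greedy_output_def)
  note inv = greedy_inv_greedy[OF assms k(1)]
  show "u_word n w"
    using u_word_if_used_eq_perms[OF inv assms used_eq_perms[OF inv assms k(2)]] .
qed

end
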